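(* Let $0\le\alpha<n$ and let $\mu$ be an upper Ahlfors $n$-dimensional measure on $\mathbb{R}^d$. Let $B$ be a Young function and suppose that, if $\alpha>0$, $B(t)/t^{n/\alpha}$ is decreasing for all $t>0$. Let $\phi_1$ be defined by $\phi_1(0)=0$ and $$\phi_1(s)=\frac{s}{h_B(s^{\alpha/n})}\quad\text{if } s>0,$$ and let $\phi$ be any function such that $\phi(s)\le C_1\phi_1(s)$ for all $s\ge 0$, for some constant $C_1$. Then there exists a constant $C$ depending only on $B$ (with $d$, $n$, $\alpha$, $C_1$ fixed) such that for all $t>0$ and all $f\in L^B_\mu(\mathbb{R}^d)$ $$\phi\Big[\mu\big(\{x\in\mathbb{R}^d:\ \mathcal{M}_{\alpha,B}(f)(x)>t\}\big)\Big]\le C\int_{\mathbb{R}^d}B\Big(\frac{|f(y)|}{t}\Big)\,d\mu(y).$$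
   Context: Fix an integer $d\ge1$ and a real number $n$ with $0<n\le d$. All cubes are cubes in $\mathbb{R}^d$ with sides parallel to the coordinate axes; $l(Q)$ is the side length of $Q$. An upper Ahlfors $n$-dimensional measure on $\mathbb{R}^d$ is a non-negative Borel measure $\mu$ with $\mu(Q)\le l(Q)^n$ for every cube $Q$. A Young function is a convex increasing function $B:[0,\infty)\to[0,\infty)$ with $B(0)=0$ and $B(t)\to\infty$ as $t\to\infty$. For a Young function $B$, $h_B(s)=\sup_{t>0}\frac{B(st)}{B(t)}$ for $0\le s<\infty$. $L^B_\mu(\mathbb{R}^d)$ is the set of measurable $f$ for which there is $\lambda>0$ with $\int_{\mathbb{R}^d}B(|f(x)|/\lambda)\,d\mu(x)<\infty$. The radial Luxemburg average is $$\|f\|_{B,Q}=\inf\Big\{\lambda>0:\ \frac1{l(Q)^n}\int_Q B\Big(\frac{|f(x)|}{\lambda}\Big)\,d\mu(x)\le 1\Big\},$$ and $\mathcal{M}_{\alpha,B}(f)(x)=\sup_{Q\ni x} l(Q)^\alpha\|f\|_{B,Q}$, the supremum being over all cubes $Q$ containing $x$. *)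

theory Defs
  imports "HOL-Analysis.Analysis"
begin

text \<open>
  Throughout, \<open>\<real>\<^sup>d\<close> is \<open>real ^ 'd\<close> with \<open>d = CARD('d)\<close>. Cubes are closed, axis-parallel and of
  positive side length; they are handled through a corner \<open>a\<close> and the side length \<open>l\<close>.
\<close>

definition cube :: "real ^ 'd \<Rightarrow> real \<Rightarrow> (real ^ 'd) set" where
  "cube a l = cbox a (\<chi> i. a $ i + l)"

definition upper_Ahlfors :: "real \<Rightarrow> (real ^ 'd) measure \<Rightarrow> bool" where
  "upper_Ahlfors n \<mu> \<longleftrightarrow>
     sets \<mu> = sets borel \<and> (\<forall>a l. 0 < l \<longrightarrow> emeasure \<mu> (cube a l) \<le> ennreal (l powr n))"

text \<open>
  Only the restriction of \<open>B\<close> to \<open>[0,\<infinity>)\<close> matters. "Increasing" is read as non-decreasing;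
  non-negativity on \<open>[0,\<infinity>)\<close> follows from monotonicity and \<open>B 0 = 0\<close>.
\<close>

definition Young_function :: "(real \<Rightarrow> real) \<Rightarrow> bool" where
  "Young_function B \<longleftrightarrow>
     convex_on {0..} B \<and> mono_on {0..} B \<and> B 0 = 0 \<and> filterlim B at_top at_top"

text \<open>
  The supremum may be infinite. The quotients are taken in \<^typ>\<open>ennreal\<close>, so that \<open>B\<close> vanishing
  near \<open>0\<close> is treated by \<open>c / 0 = \<infinity>\<close> for \<open>c > 0\<close> and \<open>0 / 0 = 0\<close>.
\<close>

definition h_fun :: "(real \<Rightarrow> real) \<Rightarrow> real \<Rightarrow> ennreal" where
  "h_fun B s = (SUP t\<in>{0<..}. ennreal (B (s * t)) / ennreal (B t))"

definition Orlicz_space :: "(real \<Rightarrow> real) \<Rightarrow> (real ^ 'd) measure \<Rightarrow> (real ^ 'd \<Rightarrow> real) set" where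
  "Orlicz_space B \<mu> =
     {f \<in> borel_measurable \<mu>. \<exists>r>0. (\<integral>\<^sup>+ x. ennreal (B (\<bar>f x\<bar> / r)) \<partial>\<mu>) < \<infinity>}"

definition Luxemburg_avg ::
  "real \<Rightarrow> (real \<Rightarrow> real) \<Rightarrow> (real ^ 'd) measure \<Rightarrow> (real ^ 'd \<Rightarrow> real) \<Rightarrow> real ^ 'd \<Rightarrow> real \<Rightarrow> ennreal"
where
  "Luxemburg_avg n B \<mu> f a l =
     Inf {ennreal r | r. 0 < r \<and>
       (\<integral>\<^sup>+ x \<in> cube a l. ennreal (B (\<bar>f x\<bar> / r)) \<partial>\<mu>) / ennreal (l powr n) \<le> 1}"

definition maximal_fun ::
  "real \<Rightarrow> real \<Rightarrow> (real \<Rightarrow> real) \<Rightarrow> (real ^ 'd) measure \<Rightarrow> (real ^ 'd \<Rightarrow> real) \<Rightarrow> real ^ 'd \<Rightarrow> ennreal"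
where
  "maximal_fun n \<alpha> B \<mu> f x =
     (SUP (a, l) \<in> {(a, l). 0 < l \<and> x \<in> cube a l}.
        ennreal (l powr \<alpha>) * Luxemburg_avg n B \<mu> f a l)"

definition phi1 :: "real \<Rightarrow> real \<Rightarrow> (real \<Rightarrow> real) \<Rightarrow> real \<Rightarrow> ennreal" where
  "phi1 n \<alpha> B s = (if s = 0 then 0 else ennreal s / h_fun B (s powr (\<alpha> / n)))"

text \<open>
  Level sets of the maximal function may have infinite measure (e.g. for \<open>B t = t powr (n / \<alpha>)\<close>),
  so \<open>\<phi>\<^sub>1\<close> is needed on \<open>[0,\<infinity>]\<close>. When \<open>B t / t powr (n / \<alpha>)\<close> is non-increasing, \<open>\<phi>\<^sub>1\<close> is
  non-decreasing (as it also is for \<open>\<alpha> = 0\<close>, where \<open>\<phi>\<^sub>1 s = s\<close>), so the supremum used as the value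
  at \<open>\<infinity>\<close> is the limit of \<open>\<phi>\<^sub>1 s\<close> as \<open>s\<close> tends to \<open>\<infinity>\<close>.
\<close>

definition phi1_ext :: "real \<Rightarrow> real \<Rightarrow> (real \<Rightarrow> real) \<Rightarrow> ennreal \<Rightarrow> ennreal" where
  "phi1_ext n \<alpha> B s =
     (if s = \<infinity> then (SUP r\<in>{0<..}. phi1 n \<alpha> B r) else phi1 n \<alpha> B (enn2real s))"

end

theory Submission
  imports Defs
begin

text \<open>
  The proof rests on two properties of \<open>\<phi>\<^sub>1 s = s / h\<^sub>B (s powr (\<alpha> / n))\<close>: it is non-decreasing,
  because for \<open>\<alpha> > 0\<close> the quotient \<open>B t / t powr (n / \<alpha>)\<close> is non-increasing (\<open>phi1_mono\<close>), and \<open>\<phi>\<^sub>1 s / s\<close> is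
  non-increasing, because \<open>h\<^sub>B\<close> is non-decreasing (\<open>h_fun_mono\<close>). Together they make \<open>\<phi>\<^sub>1\<close> countably
  subadditive up to a factor \<open>K \<ge> 1\<close>: if \<open>r \<le> K (\<Sum>i. s\<^sub>i)\<close> and every \<open>s\<^sub>i\<close> is less than \<open>r\<close>, then
  \<open>\<phi>\<^sub>1 r = r (\<phi>\<^sub>1 r / r) \<le> K (\<Sum>i. \<phi>\<^sub>1 s\<^sub>i)\<close>, while if some \<open>s\<^sub>i\<close> is at least \<open>r\<close>, then
  \<open>\<phi>\<^sub>1 r \<le> \<phi>\<^sub>1 s\<^sub>i\<close>.

  A point at which the maximal function exceeds \<open>t\<close> lies in a cube \<open>Q\<close> of side \<open>l\<close> with
  \<open>l powr \<alpha> \<parallel>f\<parallel>\<^bsub>B,Q\<^esub> > t\<close>. By definition of the Luxemburg average this gives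
  \<open>l powr n \<le> \<integral>\<^sub>Q B (l powr \<alpha> * \<bar>f\<bar> / t) \<le> h\<^sub>B (l powr \<alpha>) * \<integral>\<^sub>Q B (\<bar>f\<bar> / t)\<close>, that is,
  \<open>\<phi>\<^sub>1 (l powr n) \<le> \<integral>\<^sub>Q B (\<bar>f\<bar> / t)\<close> (\<open>phi1_le_integral_cube\<close>). So the level set is a union of cubes
  for each of which the estimate already holds with its side length to the power \<open>n\<close> in place of
  its measure.

  It remains to add these estimates up (\<open>phi1_ext_emeasure_UN_cubes_le\<close>). Let \<open>E\<close> be the level set
  and \<open>r \<le> \<mu> E\<close> a positive real. If \<open>l powr n \<ge> r\<close> for one of the cubes, that cube alone gives the
  bound for \<open>\<phi>\<^sub>1 r\<close>. Otherwise the side lengths are bounded, and Vitali's lemma selects countably many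
  disjoint cubes, of side lengths \<open>l\<^sub>i\<close>, such that cubes of side \<open>10 * d * l\<^sub>i\<close> cover \<open>E\<close>. The Ahlfors
  condition bounds the measure of each of these larger cubes directly, which takes the place of a
  doubling property: \<open>r \<le> (10 d) powr n * (\<Sum>i. l\<^sub>i powr n)\<close>, and the subadditivity above applies
  with \<open>s\<^sub>i = l\<^sub>i powr n\<close>. Arguing with each real \<open>r \<le> \<mu> E\<close> separately also covers level sets of
  infinite measure.
\<close>

section \<open>The dilation function and \<open>\<phi>\<^sub>1\<close>\<close>

lemma h_fun_mono:
  assumes "mono_on {0..} B" "0 \<le> s" "s \<le> s'"
  shows "h_fun B s \<le> h_fun B s'"
  unfolding h_fun_def
proof (rule SUP_mono)
  fix t :: real assume t: "t \<in> {0<..}"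
  then have "B (s * t) \<le> B (s' * t)"
    using assms by (intro mono_onD[OF assms(1)]) (auto intro!: mult_right_mono)
  then show "\<exists>t'\<in>{0<..}. ennreal (B (s * t)) / ennreal (B t) \<le> ennreal (B (s' * t')) / ennreal (B t')"
    using t by (intro bexI[of _ t] divide_right_mono_ennreal ennreal_leI) auto
qed

text \<open>
  The exclusion of \<open>h\<^sub>B s = \<infinity>\<close> matters when \<open>B t = 0 < B (s * t)\<close>: the right-hand side would then be
  \<open>\<infinity> * 0 = 0\<close>. If \<open>h\<^sub>B s\<close> is finite, \<open>B t = 0\<close> forces \<open>B (s * t) = 0\<close>, because
  \<open>c / 0 = \<infinity>\<close> for positive \<open>c\<close>.
\<close>

lemma le_h_fun_mult:
  assumes "0 < t" "h_fun B s \<noteq> \<infinity>"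
  shows "ennreal (B (s * t)) \<le> h_fun B s * ennreal (B t)"
proof -
  have q: "ennreal (B (s * t)) / ennreal (B t) \<le> h_fun B s"
    unfolding h_fun_def using assms by (intro SUP_upper) auto
  show ?thesis
  proof (cases "ennreal (B t) = 0")
    case True
    then have "ennreal (B (s * t)) = 0"
      using q assms(2) unfolding True ennreal_divide_zero
      by (metis infinity_ennreal_def top_unique)
    then show ?thesis by simp
  next
    case False
    have "ennreal (B (s * t)) = ennreal (B (s * t)) / ennreal (B t) * ennreal (B t)"
      using False by (metis ennreal_divide_times ennreal_divide_self ennreal_neq_top less_top mult.right_neutral)
    also have "\<dots> \<le> h_fun B s * ennreal (B t)"
      by (rule mult_right_mono[OF q]) simp
    finally show ?thesis .
  qed
qed

lemma ennreal_divide_antimono: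
  fixes a b c :: ennreal
  assumes "b \<le> c" shows "a / c \<le> a / b"
proof -
  have "inverse c \<le> inverse b"
    using assms by (simp add: less_eq_ennreal.rep_eq inverse_ennreal.rep_eq ereal_inverse_antimono)
  then show ?thesis unfolding divide_ennreal_def by (rule mult_left_mono) simp
qed

text \<open>
  For each fixed \<open>t\<close>, the quotient \<open>B (s * t) / B t\<close> divided by \<open>s powr p\<close> is non-increasing in \<open>s\<close>,
  so its supremum \<open>h\<^sub>B s / s powr p\<close> over \<open>t\<close> is non-increasing as well; the conclusion is the
  multiplied-out form of this.
\<close>

lemma h_fun_powr_le:
  assumes p: "0 < p" and anti: "antimono_on {0<..} (\<lambda>t. B t / t powr p)"
    and s: "0 < s" "s \<le> s'"
  shows "h_fun B s' \<le> ennreal ((s' / s) powr p) * h_fun B s"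
  unfolding h_fun_def
proof (rule SUP_least)
  fix t :: real assume t: "t \<in> {0<..}"
  then have t0: "0 < t" by simp
  have "B (s' * t) / (s' * t) powr p \<le> B (s * t) / (s * t) powr p"
    using s t0 by (intro monotone_onD[OF anti]) (auto intro!: mult_right_mono)
  then have "B (s' * t) \<le> B (s * t) / (s * t) powr p * (s' * t) powr p"
    using s t0 by (simp add: pos_divide_le_eq)
  also have "\<dots> = (s' / s) powr p * B (s * t)"
    using s t0 by (simp add: powr_mult powr_divide)
  finally have "ennreal (B (s' * t)) \<le> ennreal ((s' / s) powr p) * ennreal (B (s * t))"
    by (simp add: ennreal_mult'[symmetric] ennreal_leI)
  then have "ennreal (B (s' * t)) / ennreal (B t)
      \<le> ennreal ((s' / s) powr p) * (ennreal (B (s * t)) / ennreal (B t))"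
    by (simp add: ennreal_times_divide divide_right_mono_ennreal)
  also have "\<dots> \<le> ennreal ((s' / s) powr p) * (SUP t\<in>{0<..}. ennreal (B (s * t)) / ennreal (B t))"
    using t by (intro mult_left_mono SUP_upper) auto
  finally show "ennreal (B (s' * t)) / ennreal (B t) \<le> \<dots>" .
qed

text \<open>
  For \<open>\<alpha> = 0\<close> the denominator does not depend on \<open>s\<close>. For \<open>\<alpha> > 0\<close>, \<open>h_fun_powr_le\<close> with
  \<open>p = n / \<alpha>\<close> says that the denominator grows at most by the factor \<open>s' / s\<close>.
\<close>

lemma phi1_mono:
  assumes n: "0 < n" and \<alpha>: "0 \<le> \<alpha>"
    and anti: "\<alpha> > 0 \<Longrightarrow> antimono_on {0<..} (\<lambda>t. B t / t powr (n / \<alpha>))"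
    and s: "0 < s" "s \<le> s'"
  shows "phi1 n \<alpha> B s \<le> phi1 n \<alpha> B s'"
proof (cases "\<alpha> = 0")
  case True
  then show ?thesis using s by (auto simp: phi1_def intro!: divide_right_mono_ennreal ennreal_leI)
next
  case False
  then have \<alpha>0: "0 < \<alpha>" using \<alpha> by simp
  define h where "h s = h_fun B (s powr (\<alpha> / n))" for s
  have "h s' \<le> ennreal ((s' powr (\<alpha> / n) / s powr (\<alpha> / n)) powr (n / \<alpha>)) * h s"
    unfolding h_def using n \<alpha>0 s by (intro h_fun_powr_le anti) (auto intro: powr_mono2)
  also have "(s' powr (\<alpha> / n) / s powr (\<alpha> / n)) powr (n / \<alpha>) = s' / s"
    using n \<alpha>0 s by (simp add: powr_divide powr_powr)
  finally have h: "h s' \<le> ennreal (s' / s) * h s" .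
  \<comment> \<open>Expand the fraction by \<open>s' / s\<close>, which turns the numerator into \<open>s'\<close>.\<close>
  have "ennreal s / h s = ennreal (s' / s) * ennreal s / (ennreal (s' / s) * h s)"
    using s by (subst (1 2) mult.commute) (simp add: divide_mult_eq mult.commute)
  also have "\<dots> = ennreal s' / (ennreal (s' / s) * h s)"
    using s by (simp add: ennreal_mult'[symmetric])
  also have "\<dots> \<le> ennreal s' / h s'"
    by (rule ennreal_divide_antimono[OF h])
  finally show ?thesis using s by (simp add: phi1_def h_def)
qed

text \<open>
  Reduces a bound at a possibly infinite argument to bounds for \<open>\<phi>\<^sub>1\<close> at positive reals: the value
  at \<open>\<infinity>\<close> is a supremum of such values, and the value at \<open>0\<close> is \<open>0\<close>.
\<close>

lemma phi1_ext_leI: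
  assumes "\<And>r. 0 < r \<Longrightarrow> ennreal r \<le> S \<Longrightarrow> phi1 n \<alpha> B r \<le> X"
  shows "phi1_ext n \<alpha> B S \<le> X"
proof (cases "S = \<infinity>")
  case True
  then show ?thesis using assms by (auto simp: phi1_ext_def intro!: SUP_least)
next
  case False
  then have "ennreal (enn2real S) = S" by (simp add: less_top)
  moreover have "enn2real S = 0 \<or> 0 < enn2real S"
    using enn2real_nonneg[of S] by linarith
  ultimately show ?thesis using False assms[of "enn2real S"]
    by (auto simp: phi1_ext_def phi1_def)
qed

section \<open>Covering by disjoint cubes\<close>

lemma cube_subset_cball:
  fixes a :: "real ^ 'd"
  assumes "0 < l" shows "cube a l \<subseteq> cball a (real CARD('d) * l)"
proof
  fix x assume "x \<in> cube a l"
  then have "\<bar>(x - a) $ i\<bar> \<le> l" for i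
    by (auto simp: cube_def mem_box_cart abs_le_iff dest!: spec[of _ i])
  then have "norm (x - a) \<le> (\<Sum>i\<in>(UNIV::'d set). l)"
    by (intro order_trans[OF norm_le_l1_cart] sum_mono) auto
  then show "x \<in> cball a (real CARD('d) * l)"
    by (simp add: dist_norm norm_minus_commute)
qed

lemma cball_subset_cube:
  fixes a :: "real ^ 'd"
  shows "cball a r \<subseteq> cube (\<chi> i. a $ i - r) (2 * r)"
proof
  fix x assume "x \<in> cball a r"
  then have "\<bar>(x - a) $ i\<bar> \<le> r" for i
    using component_le_norm_cart[of "x - a" i] by (auto simp: dist_norm norm_minus_commute)
  then show "x \<in> cube (\<chi> i. a $ i - r) (2 * r)"
    by (auto simp: cube_def mem_box_cart abs_le_iff algebra_simps)
qed

lemma emeasure_UN_le_count_space: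
  assumes "countable I" "\<And>i. i \<in> I \<Longrightarrow> X i \<in> sets M"
  shows "emeasure M (\<Union>i\<in>I. X i) \<le> (\<integral>\<^sup>+i. emeasure M (X i) \<partial>count_space I)"
proof -
  note [measurable] = assms(2)
  have U: "(\<Union>i\<in>I. X i) \<in> sets M" using assms by (rule sets.countable_UN'')
  have "emeasure M (\<Union>i\<in>I. X i) = (\<integral>\<^sup>+x. indicator (\<Union>i\<in>I. X i) x \<partial>M)"
    using U by simp
  also have "\<dots> \<le> (\<integral>\<^sup>+x. \<integral>\<^sup>+i. indicator (X i) x \<partial>count_space I \<partial>M)"
  proof (intro nn_integral_mono)
    fix x
    show "indicator (\<Union>i\<in>I. X i) x \<le> (\<integral>\<^sup>+i. indicator (X i) x \<partial>count_space I :: ennreal)"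
    proof (cases "x \<in> (\<Union>i\<in>I. X i)")
      case True
      then obtain i where "i \<in> I" "x \<in> X i" by auto
      then show ?thesis
        using nn_integral_ge_point[of i I "\<lambda>i. indicator (X i) x"] True by simp
    qed simp
  qed
  also have "\<dots> = (\<integral>\<^sup>+i. \<integral>\<^sup>+x. indicator (X i) x \<partial>M \<partial>count_space I)"
    using assms by (intro nn_integral_count_space_nn_integral) auto
  also have "\<dots> = (\<integral>\<^sup>+i. emeasure M (X i) \<partial>count_space I)"
    using assms by (intro nn_integral_cong) auto
  finally show ?thesis .
qed

text \<open>
  Vitali's lemma is applied to the Euclidean balls centred at the corners \<open>a\<close> of radius \<open>d * l\<close>,
  which contain the cubes, so disjointness of the balls gives disjointness of the cubes. The balls of
  five times the radius are then enclosed in cubes of side \<open>10 * d * l\<close>.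
\<close>

lemma Vitali_covering_cubes:
  fixes K :: "((real ^ 'd) \<times> real) set"
  assumes "\<And>a l. (a, l) \<in> K \<Longrightarrow> 0 < l \<and> l \<le> L"
  obtains C where "countable C" "C \<subseteq> K" "disjoint_family_on (\<lambda>(a, l). cube a l) C"
    "(\<Union>(a, l)\<in>K. cube a l)
       \<subseteq> (\<Union>(a, l)\<in>C. cube (\<chi> i. a $ i - 5 * (real CARD('d) * l)) (10 * real CARD('d) * l))"
proof -
  define rad where "rad k = real CARD('d) * snd k" for k :: "(real ^ 'd) \<times> real"
  have sub: "(case k of (a, l) \<Rightarrow> cube a l) \<subseteq> cball (fst k) (rad k)" if "k \<in> K" for k
  proof -
    obtain a l where k: "k = (a, l)" by (cases k)
    then show ?thesis
      using assms[of a l] that cube_subset_cball[of l a] by (simp add: rad_def)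
  qed
  have rad: "0 < rad k \<and> rad k \<le> CARD('d) * L" if "k \<in> K" for k
  proof -
    obtain a l where k: "k = (a, l)" by (cases k)
    then show ?thesis
      using assms[of a l] that by (simp add: rad_def)
  qed
  have "(\<Union>(a, l)\<in>K. cube a l) \<subseteq> (\<Union>k\<in>K. cball (fst k) (rad k))"
    using sub by blast
  then obtain C where C: "countable C" "C \<subseteq> K"
    "pairwise (\<lambda>i j. disjnt (cball (fst i) (rad i)) (cball (fst j) (rad j))) C"
    "(\<Union>(a, l)\<in>K. cube a l) \<subseteq> (\<Union>k\<in>C. cball (fst k) (5 * rad k))"
    using rad by (rule Vitali_covering_lemma_cballs)
  show thesis
  proof (rule that[OF C(1,2)])
    show "disjoint_family_on (\<lambda>(a, l). cube a l) C"
      unfolding disjoint_family_on_def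
    proof (intro ballI impI)
      fix i j assume ij: "i \<in> C" "j \<in> C" "i \<noteq> j"
      then have "cball (fst i) (rad i) \<inter> cball (fst j) (rad j) = {}"
        using C(3) unfolding pairwise_def disjnt_def by blast
      moreover have "i \<in> K" "j \<in> K" using ij C(2) by auto
      ultimately show "(case i of (a, l) \<Rightarrow> cube a l) \<inter> (case j of (a, l) \<Rightarrow> cube a l) = {}"
        using sub[of i] sub[of j] by blast
    qed
    have "cball (fst k) (5 * rad k)
        \<subseteq> (case k of (a, l) \<Rightarrow> cube (\<chi> i. a $ i - 5 * (real CARD('d) * l)) (10 * real CARD('d) * l))" for k
      using cball_subset_cube[of "fst k" "5 * rad k"] by (cases k) (simp add: rad_def mult.assoc)
    then show "(\<Union>(a, l)\<in>K. cube a l)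
       \<subseteq> (\<Union>(a, l)\<in>C. cube (\<chi> i. a $ i - 5 * (real CARD('d) * l)) (10 * real CARD('d) * l))"
      by (intro order_trans[OF C(4)] UN_mono) auto
  qed
qed

text \<open>
  This is where the estimates on single cubes are added up. For \<open>r \<le> \<mu> E\<close>, either one of the cubes
  has \<open>l powr n \<ge> r\<close>, and monotonicity of \<open>\<phi>\<^sub>1\<close> finishes with that cube alone, or all side lengths
  are bounded by \<open>r powr (1 / n)\<close>, so that Vitali's lemma applies. In the second case the weight
  \<open>1 / h\<^sub>B\<close> at \<open>r\<close> is no larger than the weight at each \<open>l powr n\<close>, which turns the sum of the
  \<open>l powr n\<close> into a sum of values of \<open>\<phi>\<^sub>1\<close>, and disjointness turns the sum of the integrals into
  one integral. The set \<open>E\<close> may fail to be measurable: \<open>emeasure_mono\<close> asks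
  measurability of the covering set only.
\<close>

lemma phi1_ext_emeasure_UN_cubes_le:
  fixes \<mu> :: "(real ^ 'd) measure" and K :: "((real ^ 'd) \<times> real) set"
  assumes n: "0 < n" and \<alpha>: "0 \<le> \<alpha>"
    and mono: "mono_on {0..} B"
    and anti: "\<alpha> > 0 \<Longrightarrow> antimono_on {0<..} (\<lambda>t. B t / t powr (n / \<alpha>))"
    and \<mu>: "upper_Ahlfors n \<mu>" and g[measurable]: "g \<in> borel_measurable \<mu>"
    and K: "\<And>a l. (a, l) \<in> K \<Longrightarrow> 0 < l \<and> phi1 n \<alpha> B (l powr n) \<le> (\<integral>\<^sup>+x\<in>cube a l. g x \<partial>\<mu>)"
    and E: "E \<subseteq> (\<Union>(a, l)\<in>K. cube a l)"
  shows "phi1_ext n \<alpha> B (emeasure \<mu> E)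
           \<le> ennreal ((10 * real CARD('d)) powr n) * (\<integral>\<^sup>+x. g x \<partial>\<mu>)"
proof (rule phi1_ext_leI)
  fix r :: real assume r: "0 < r" "ennreal r \<le> emeasure \<mu> E"
  let ?D = "real CARD('d)"
  let ?I = "\<integral>\<^sup>+x. g x \<partial>\<mu>"
  have D1: "1 \<le> (10 * ?D) powr n"
  proof (rule ge_one_powr_ge_zero)
    have "1 \<le> ?D" by (simp add: Suc_leI)
    then show "1 \<le> 10 * ?D" by linarith
  qed (use n in simp)
  have setI: "(\<integral>\<^sup>+x\<in>A. g x \<partial>\<mu>) \<le> ?I" for A
    by (intro nn_integral_mono) (auto simp: indicator_def)
  have sets[measurable]: "cube a l \<in> sets \<mu>" for a l
    using \<mu> by (simp add: upper_Ahlfors_def cube_def)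
  show "phi1 n \<alpha> B r \<le> ennreal ((10 * ?D) powr n) * ?I"
  proof (cases "\<exists>(a, l)\<in>K. r \<le> l powr n")
    case True
    then obtain a l where al: "(a, l) \<in> K" "r \<le> l powr n" by auto
    have "phi1 n \<alpha> B r \<le> phi1 n \<alpha> B (l powr n)"
      by (rule phi1_mono) (use n \<alpha> anti r al in auto)
    also have "\<dots> \<le> ?I"
      using K[OF al(1)] setI order_trans by blast
    also have "\<dots> = 1 * ?I" by simp
    also have "\<dots> \<le> ennreal ((10 * ?D) powr n) * ?I"
      using D1 by (intro mult_right_mono) auto
    finally show ?thesis .
  next
    case False
    then have small: "l powr n < r" if "(a, l) \<in> K" for a l
      using that by force
    have "0 < l \<and> l \<le> r powr (1 / n)" if "(a, l) \<in> K" for a l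
    proof -
      have "(l powr n) powr (1 / n) \<le> r powr (1 / n)"
        using small[OF that] n by (intro powr_mono2) auto
      then show ?thesis using K[OF that] n by (simp add: powr_powr)
    qed
    then obtain C where C: "countable C" "C \<subseteq> K" "disjoint_family_on (\<lambda>(a, l). cube a l) C"
      "(\<Union>(a, l)\<in>K. cube a l)
         \<subseteq> (\<Union>(a, l)\<in>C. cube (\<chi> i. a $ i - 5 * (?D * l)) (10 * ?D * l))"
      by (rule Vitali_covering_cubes)
    define Q' where "Q' k = (case k of (a, l) \<Rightarrow> cube (\<chi> i. a $ i - 5 * (?D * l)) (10 * ?D * l))"
      for k :: "(real ^ 'd) \<times> real"
    have pos: "0 < snd k" if "k \<in> C" for k
      using K that C(2) by (cases k) auto
    have Q': "emeasure \<mu> (Q' k) \<le> ennreal ((10 * ?D) powr n) * ennreal (snd k powr n)" if "k \<in> C" for k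
      using \<mu> pos[OF that] unfolding upper_Ahlfors_def Q'_def
      by (cases k) (simp add: ennreal_mult[symmetric] powr_mult[symmetric])
    have Q'_sets: "Q' k \<in> sets \<mu>" for k
      by (cases k) (simp add: Q'_def sets)
    have E_sub: "E \<subseteq> (\<Union>k\<in>C. Q' k)"
      using E C(4) unfolding Q'_def by (rule order_trans)
    let ?h = "\<lambda>s. h_fun B (s powr (\<alpha> / n))"
    \<comment> \<open>Over the selected cubes, the \<open>l powr n\<close> add up to at least a fixed fraction of \<open>r\<close>.\<close>
    have "ennreal r \<le> emeasure \<mu> (\<Union>k\<in>C. Q' k)"
      by (rule order_trans[OF r(2) emeasure_mono[OF E_sub]])
        (use C(1) Q'_sets in \<open>auto intro!: sets.countable_UN''\<close>)
    also have "\<dots> \<le> (\<integral>\<^sup>+k. emeasure \<mu> (Q' k) \<partial>count_space C)"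
      by (rule emeasure_UN_le_count_space) (use C(1) Q'_sets in auto)
    also have "\<dots> \<le> (\<integral>\<^sup>+k. ennreal ((10 * ?D) powr n) * ennreal (snd k powr n) \<partial>count_space C)"
      by (intro nn_integral_mono) (use Q' in auto)
    finally have r_le: "ennreal r
        \<le> ennreal ((10 * ?D) powr n) * (\<integral>\<^sup>+k. ennreal (snd k powr n) \<partial>count_space C)"
      by (simp add: nn_integral_cmult)
    have "phi1 n \<alpha> B r = ennreal r / ?h r" using r by (simp add: phi1_def)
    also have "\<dots> \<le> ennreal ((10 * ?D) powr n) * (\<integral>\<^sup>+k. ennreal (snd k powr n) \<partial>count_space C) / ?h r"
      by (rule divide_right_mono_ennreal[OF r_le])
    also have "\<dots> = ennreal ((10 * ?D) powr n) * (\<integral>\<^sup>+k. ennreal (snd k powr n) / ?h r \<partial>count_space C)"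
      by (simp add: nn_integral_divide ennreal_times_divide)
    \<comment> \<open>The integrals over the disjoint cubes are values of the measure \<open>density \<mu> g\<close>, so that
      countable additivity adds them up.\<close>
    also have "\<dots> \<le> ennreal ((10 * ?D) powr n)
        * (\<integral>\<^sup>+k. emeasure (density \<mu> g) (case k of (a, l) \<Rightarrow> cube a l) \<partial>count_space C)"
    proof (intro mult_left_mono nn_integral_mono)
      fix k assume "k \<in> space (count_space C)"
      then have k: "k \<in> C" by simp
      obtain a l where al: "k = (a, l)" by (cases k)
      have alK: "(a, l) \<in> K" using k C(2) al by auto
      have "ennreal (l powr n) / ?h r \<le> ennreal (l powr n) / ?h (l powr n)"
        using small[OF alK] n \<alpha> by (intro ennreal_divide_antimono h_fun_mono mono powr_mono2) auto
      also have "\<dots> = phi1 n \<alpha> B (l powr n)"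
        using pos[OF k] al by (simp add: phi1_def)
      also have "\<dots> \<le> emeasure (density \<mu> g) (cube a l)"
        using K[OF alK] by (simp add: emeasure_density)
      finally show "ennreal (snd k powr n) / ?h r
          \<le> emeasure (density \<mu> g) (case k of (a, l) \<Rightarrow> cube a l)"
        by (simp add: al)
    qed simp
    also have "(\<integral>\<^sup>+k. emeasure (density \<mu> g) (case k of (a, l) \<Rightarrow> cube a l) \<partial>count_space C)
        = emeasure (density \<mu> g) (\<Union>(a, l)\<in>C. cube a l)"
      by (rule emeasure_UN_countable[symmetric]) (use C(1,3) sets in auto)
    also have "\<dots> = (\<integral>\<^sup>+x\<in>(\<Union>(a, l)\<in>C. cube a l). g x \<partial>\<mu>)"
      by (intro emeasure_density g sets.countable_UN'') (use C(1) sets in auto)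
    also have "ennreal ((10 * ?D) powr n) * \<dots> \<le> ennreal ((10 * ?D) powr n) * ?I"
      by (intro mult_left_mono setI) simp
    finally show ?thesis .
  qed
qed

section \<open>The level sets of the maximal function\<close>

text \<open>
  The hypothesis says that \<open>t / l powr \<alpha>\<close> lies strictly below the infimum defining the Luxemburg
  average, hence is not admissible there: the integral of \<open>B (l powr \<alpha> * \<bar>f\<bar> / t)\<close> over the cube
  exceeds \<open>l powr n\<close>. Pulling the factor \<open>l powr \<alpha>\<close> out of \<open>B\<close> costs \<open>h\<^sub>B (l powr \<alpha>)\<close>, which is
  exactly the denominator of \<open>\<phi>\<^sub>1 (l powr n)\<close>.
\<close>

lemma phi1_le_integral_cube:
  fixes f :: "real ^ 'd \<Rightarrow> real"
  assumes n: "0 < n" and l: "0 < l" and t: "0 < t" and B0: "B 0 = 0"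
    and meas[measurable]: "(\<lambda>x. ennreal (B (\<bar>f x\<bar> / t))) \<in> borel_measurable \<mu>"
    and Q[measurable]: "cube a l \<in> sets \<mu>"
    and gt: "ennreal t < ennreal (l powr \<alpha>) * Luxemburg_avg n B \<mu> f a l"
  shows "phi1 n \<alpha> B (l powr n) \<le> (\<integral>\<^sup>+x\<in>cube a l. ennreal (B (\<bar>f x\<bar> / t)) \<partial>\<mu>)"
proof -
  let ?r = "t / l powr \<alpha>"
  let ?J = "\<integral>\<^sup>+x\<in>cube a l. ennreal (B (\<bar>f x\<bar> / ?r)) \<partial>\<mu>"
  let ?I = "\<integral>\<^sup>+x\<in>cube a l. ennreal (B (\<bar>f x\<bar> / t)) \<partial>\<mu>"
  let ?h = "h_fun B (l powr \<alpha>)"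
  have ln: "0 < ennreal (l powr n)" "ennreal (l powr n) < top" using l by auto
  have "\<not> ?J / ennreal (l powr n) \<le> 1"
  proof
    assume "?J / ennreal (l powr n) \<le> 1"
    then have "Luxemburg_avg n B \<mu> f a l \<le> ennreal ?r"
      unfolding Luxemburg_avg_def using t l by (intro Inf_lower) auto
    then have "ennreal (l powr \<alpha>) * Luxemburg_avg n B \<mu> f a l \<le> ennreal (l powr \<alpha>) * ennreal ?r"
      by (intro mult_left_mono) auto
    also have "\<dots> = ennreal t" using l t by (simp add: ennreal_mult[symmetric])
    finally show False using gt by simp
  qed
  then have J: "ennreal (l powr n) \<le> ?J"
    using divide_le_posI_ennreal[OF ln(1), of ?J 1] linear by auto
  have phi: "phi1 n \<alpha> B (l powr n) = ennreal (l powr n) / ?h"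
    using n l by (simp add: phi1_def powr_powr)
  show ?thesis
  proof (cases "?h = \<infinity>")
    case True
    then show ?thesis by (simp add: phi)
  next
    case False
    have "ennreal (B (\<bar>f x\<bar> / ?r)) \<le> ?h * ennreal (B (\<bar>f x\<bar> / t))" for x
    proof (cases "f x = 0")
      case True then show ?thesis by (simp add: B0)
    next
      case fx: False
      then show ?thesis
        using le_h_fun_mult[of "\<bar>f x\<bar> / t" B "l powr \<alpha>"] False t by (simp add: mult.commute)
    qed
    then have "?J \<le> (\<integral>\<^sup>+x. ?h * (ennreal (B (\<bar>f x\<bar> / t)) * indicator (cube a l) x) \<partial>\<mu>)"
      by (intro nn_integral_mono) (auto simp: indicator_def)
    also have "\<dots> = ?h * ?I" by (intro nn_integral_cmult) measurable
    finally have le: "ennreal (l powr n) \<le> ?I * ?h" using J by (simp add: mult.commute)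
    have "?h \<noteq> 0" using le ln(1) by auto
    then have "0 < ?h" by (simp add: zero_less_iff_neq_zero)
    then show ?thesis unfolding phi using le by (intro divide_le_posI_ennreal) (auto simp: mult.commute)
  qed
qed

lemma borel_measurable_mono_on_nonneg_comp:
  fixes B :: "real \<Rightarrow> real"
  assumes "mono_on {0..} B" and [measurable]: "g \<in> borel_measurable M" and "\<And>x. 0 \<le> g x"
  shows "(\<lambda>x. B (g x)) \<in> borel_measurable M"
proof -
  have "mono (\<lambda>x. B (max 0 x))"
    by (intro monoI mono_onD[OF assms(1)]) auto
  then have [measurable]: "(\<lambda>x. B (max 0 x)) \<in> borel_measurable borel"
    by (rule borel_measurable_mono)
  have "(\<lambda>x. B (max 0 (g x))) \<in> borel_measurable M" by measurable
  moreover have "max 0 (g x) = g x" for x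
    using assms(3)[of x] by (rule max_absorb2)
  ultimately show ?thesis by simp
qed

lemma phi1_ext_maximal_fun_le:
  fixes \<mu> :: "(real ^ 'd) measure"
  assumes n: "0 < n" and \<alpha>: "0 \<le> \<alpha>"
    and mono: "mono_on {0..} B" and B0: "B 0 = 0"
    and anti: "\<alpha> > 0 \<Longrightarrow> antimono_on {0<..} (\<lambda>t. B t / t powr (n / \<alpha>))"
    and \<mu>: "upper_Ahlfors n \<mu>" and f[measurable]: "f \<in> borel_measurable \<mu>" and t: "0 < t"
  shows "phi1_ext n \<alpha> B (emeasure \<mu> {x. maximal_fun n \<alpha> B \<mu> f x > ennreal t})
    \<le> ennreal ((10 * real CARD('d)) powr n) * (\<integral>\<^sup>+ y. ennreal (B (\<bar>f y\<bar> / t)) \<partial>\<mu>)"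
proof (rule phi1_ext_emeasure_UN_cubes_le[OF n \<alpha> mono anti \<mu>])
  let ?K = "{(a, l). 0 < l \<and> ennreal t < ennreal (l powr \<alpha>) * Luxemburg_avg n B \<mu> f a l}"
  have "(\<lambda>y. B (\<bar>f y\<bar> / t)) \<in> borel_measurable \<mu>"
    by (rule borel_measurable_mono_on_nonneg_comp[OF mono]) (use t in auto)
  then show meas: "(\<lambda>y. ennreal (B (\<bar>f y\<bar> / t))) \<in> borel_measurable \<mu>" by measurable
  show "0 < l \<and> phi1 n \<alpha> B (l powr n) \<le> (\<integral>\<^sup>+x\<in>cube a l. ennreal (B (\<bar>f x\<bar> / t)) \<partial>\<mu>)"
    if "(a, l) \<in> ?K" for a l
  proof -
    have "cube a l \<in> sets \<mu>" using \<mu> by (simp add: upper_Ahlfors_def cube_def)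
    then show ?thesis using that phi1_le_integral_cube[OF n _ t B0 meas] by simp
  qed
  show "{x. maximal_fun n \<alpha> B \<mu> f x > ennreal t} \<subseteq> (\<Union>(a, l)\<in>?K. cube a l)"
  proof
    fix x assume "x \<in> {x. maximal_fun n \<alpha> B \<mu> f x > ennreal t}"
    then obtain a l where "0 < l" "x \<in> cube a l"
      "ennreal t < ennreal (l powr \<alpha>) * Luxemburg_avg n B \<mu> f a l"
      unfolding maximal_fun_def less_SUP_iff mem_Collect_eq by auto
    then have "(a, l) \<in> ?K" "x \<in> (case (a, l) of (a, l) \<Rightarrow> cube a l)" by auto
    then show "x \<in> (\<Union>(a, l)\<in>?K. cube a l)" by (rule UN_I)
  qed
qed

theorem theorem1p5:
  fixes n \<alpha> C1 :: real and B :: "real \<Rightarrow> real"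
  assumes "0 < n" and "n \<le> real CARD('d::finite)"
    and "0 \<le> \<alpha>" and "\<alpha> < n"
    and "Young_function B"
    and "\<alpha> > 0 \<Longrightarrow> antimono_on {0<..} (\<lambda>t. B t / t powr (n / \<alpha>))"
  shows "\<exists>C::real. 0 < C \<and>
    (\<forall>(\<mu> :: (real ^ 'd) measure) (\<phi> :: ennreal \<Rightarrow> ereal).
       upper_Ahlfors n \<mu> \<longrightarrow>
       (\<forall>s. \<phi> s \<le> ereal C1 * enn2ereal (phi1_ext n \<alpha> B s)) \<longrightarrow>
       (\<forall>t>0. \<forall>f\<in>Orlicz_space B \<mu>.
          \<phi> (emeasure \<mu> {x. maximal_fun n \<alpha> B \<mu> f x > ennreal t})
            \<le> ereal C * enn2ereal (\<integral>\<^sup>+ y. ennreal (B (\<bar>f y\<bar> / t)) \<partial>\<mu>)))"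
proof -
  let ?K = "(10 * real CARD('d)) powr n"
  \<comment> \<open>\<open>C1\<close> may be zero or negative, whereas \<open>C\<close> must be positive.\<close>
  define C where "C = max 1 C1 * ?K"
  have "0 < C" by (simp add: C_def)
  moreover have "\<phi> (emeasure \<mu> {x. maximal_fun n \<alpha> B \<mu> f x > ennreal t})
      \<le> ereal C * enn2ereal (\<integral>\<^sup>+ y. ennreal (B (\<bar>f y\<bar> / t)) \<partial>\<mu>)"
    if \<mu>: "upper_Ahlfors n \<mu>" and \<phi>: "\<forall>s. \<phi> s \<le> ereal C1 * enn2ereal (phi1_ext n \<alpha> B s)"
      and t: "0 < t" and f: "f \<in> Orlicz_space B \<mu>"
    for \<mu> :: "(real ^ 'd) measure" and \<phi> :: "ennreal \<Rightarrow> ereal" and t f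
  proof -
    let ?S = "emeasure \<mu> {x. maximal_fun n \<alpha> B \<mu> f x > ennreal t}"
    let ?I = "\<integral>\<^sup>+ y. ennreal (B (\<bar>f y\<bar> / t)) \<partial>\<mu>"
    have "phi1_ext n \<alpha> B ?S \<le> ennreal ?K * ?I"
      using assms(5) f
      by (intro phi1_ext_maximal_fun_le assms(1,3,6) \<mu> t)
        (auto simp: Young_function_def Orlicz_space_def)
    then have bd: "enn2ereal (phi1_ext n \<alpha> B ?S) \<le> ereal ?K * enn2ereal ?I"
      by (simp add: less_eq_ennreal.rep_eq times_ennreal.rep_eq enn2ereal_ennreal)
    have "\<phi> ?S \<le> ereal C1 * enn2ereal (phi1_ext n \<alpha> B ?S)" using \<phi> by blast
    also have "\<dots> \<le> ereal (max 1 C1) * enn2ereal (phi1_ext n \<alpha> B ?S)"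
      by (intro ereal_mult_right_mono) auto
    also have "\<dots> \<le> ereal (max 1 C1) * (ereal ?K * enn2ereal ?I)"
      by (intro ereal_mult_left_mono bd) (auto simp: le_max_iff_disj)
    also have "\<dots> = ereal C * enn2ereal ?I"
      unfolding C_def times_ereal.simps(1)[symmetric] by (rule mult.assoc[symmetric])
    finally show ?thesis .
  qed
  ultimately show ?thesis by blast
qed

end
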